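(* Let $f\in \mathrm{LC}_g(\mathbb{R}^n)$ and for $0<\lambda<1$ let $f_\lambda(x)=f(x/\lambda)^{\lambda}$. If $f$ is even, then $$\lim_{\lambda\to1^-}N(f,f_\lambda)\le2^{n}.$$ If $f$ is not even, then $$\lim_{\lambda\to1^-}N(f,f_\lambda)\le4^{n}.$$
   Context: $\mathrm{LC}_g(\mathbb{R}^n)$ is the class of geometric log-concave functions: upper semi-continuous $f:\mathbb{R}^n\to[0,1]$ with $-\log f$ convex (values in $[0,\infty]$), $\max f=f(0)=1$, and $0<\int f<\infty$. The functional covering number is $N(f,g)=\inf\{\mu(\mathbb{R}^n)\}$ over all non-negative Borel measures $\mu$ on $\mathbb{R}^n$ such that $(\mu*g)(x)=\int g(x-t)\,d\mu(t)\ge f(x)$ for all $x\in\mathbb{R}^n$. *)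

theory Defs
  imports "HOL-Analysis.Analysis"
begin

definition upper_semicontinuous :: "('a::topological_space \<Rightarrow> real) \<Rightarrow> bool" where
  "upper_semicontinuous f \<longleftrightarrow> (\<forall>x. \<forall>c > f x. \<forall>\<^sub>F y in nhds x. f y < c)"

definition neg_log :: "('a \<Rightarrow> real) \<Rightarrow> 'a \<Rightarrow> ereal" where
  "neg_log f x = (if f x = 0 then \<infinity> else ereal (- ln (f x)))"

text \<open>The endpoints \<open>u = 0\<close> and \<open>v = 0\<close> are harmless, since \<open>0 * \<infinity> = 0\<close> in \<^typ>\<open>ereal\<close>.\<close>

definition ereal_convex :: "('a::real_vector \<Rightarrow> ereal) \<Rightarrow> bool" where
  "ereal_convex \<phi> \<longleftrightarrow>
    (\<forall>x y. \<forall>u\<ge>0. \<forall>v\<ge>0. u + v = 1 \<longrightarrow>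
      \<phi> (u *\<^sub>R x + v *\<^sub>R y) \<le> ereal u * \<phi> x + ereal v * \<phi> y)"

definition LC_g :: "(real ^ 'n \<Rightarrow> real) set" where
  "LC_g = {f. (\<forall>x. f x \<in> {0..1}) \<and> upper_semicontinuous f \<and> ereal_convex (neg_log f) \<and>
      f 0 = 1 \<and>
      0 < (\<integral>\<^sup>+ x. ennreal (f x) \<partial>lborel) \<and> (\<integral>\<^sup>+ x. ennreal (f x) \<partial>lborel) < \<infinity>}"

text \<open>The convolution of a Borel measure with a non-negative function; it may take the value \<open>\<infinity>\<close>.\<close>

definition conv_fun :: "(real ^ 'n) measure \<Rightarrow> (real ^ 'n \<Rightarrow> real) \<Rightarrow> real ^ 'n \<Rightarrow> ennreal" where
  "conv_fun \<mu> g x = (\<integral>\<^sup>+ t. ennreal (g (x - t)) \<partial>\<mu>)"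

text \<open>Meant for non-negative functions \<open>f\<close>, \<open>g\<close>. Arbitrary Borel measures are admitted,
  finite or not; the infimum is taken in \<^typ>\<open>ennreal\<close>, so it is \<open>\<infinity>\<close> if there is no
  covering measure of finite mass.\<close>

definition covering_number :: "(real ^ 'n \<Rightarrow> real) \<Rightarrow> (real ^ 'n \<Rightarrow> real) \<Rightarrow> ennreal" where
  "covering_number f g =
    Inf {emeasure \<mu> UNIV | \<mu>. sets \<mu> = sets borel \<and> (\<forall>x. ennreal (f x) \<le> conv_fun \<mu> g x)}"

text \<open>Here \<open>0 powr l = 0\<close>, as required at the zeros of \<open>f\<close>.\<close>

definition dilate :: "real \<Rightarrow> (real ^ 'n \<Rightarrow> real) \<Rightarrow> real ^ 'n \<Rightarrow> real" where
  "dilate l f x = f (x /\<^sub>R l) powr l"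

end

theory Submission
  imports Defs
begin

text \<open>For \<open>g = f\<^sub>\<lambda> \<le> f\<close> and any point \<open>c\<close>, log-concavity gives
  \<open>f x * g (c - (x - t)) \<le> (f ((c + t) / 2))\<^sup>2\<close>. Hence the measure with density
  \<open>t \<mapsto> (f ((c + t) / 2))\<^sup>2\<close>, divided by \<open>(g * g) c\<close>, covers \<open>f\<close> by \<open>g\<close>, that is,
  \<open>N(f,g) (g * g) c \<le> 2\<^sup>n \<integral> f\<^sup>2\<close>. If \<open>f\<close> is even, take \<open>c = 0\<close>. In general, average over \<open>c\<close>
  with the weight \<open>(g (c / 2))\<^sup>2\<close>, which is at least \<open>g x * g (c - x)\<close>: this yields
  \<open>N(f,g) (\<integral> g\<^sup>2)\<^sup>2 \<le> 4\<^sup>n (\<integral> f\<^sup>2) (\<integral> g\<^sup>2)\<close>. Finally \<open>\<integral> f\<^sub>\<lambda>\<^sup>2 \<ge> \<lambda>\<^sup>n \<integral> f\<^sup>2\<close>, and the limit exists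
  because \<open>f\<^sub>\<lambda>\<close> increases with \<open>\<lambda>\<close>.\<close>

section \<open>Affine substitution, measurability, and comparison of covering numbers\<close>

lemma nn_integral_lborel_affine:
  fixes F :: "'a::euclidean_space \<Rightarrow> ennreal"
  assumes "F \<in> borel_measurable borel" "c \<noteq> 0"
  shows "(\<integral>\<^sup>+ x. F x \<partial>lborel) = ennreal (\<bar>c\<bar> ^ DIM('a)) * (\<integral>\<^sup>+ x. F (a + c *\<^sub>R x) \<partial>lborel)"
  using assms
  by (subst lborel_affine[OF assms(2), of a])
    (simp add: nn_integral_density nn_integral_distr nn_integral_cmult)

lemma upper_semicontinuous_borel_measurable:
  fixes f :: "'a::topological_space \<Rightarrow> real"
  assumes "upper_semicontinuous f"
  shows "f \<in> borel_measurable borel"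
proof (rule borel_measurableI_less)
  fix y
  have "open {x. f x < y}"
    using assms unfolding upper_semicontinuous_def
    by (subst open_subopen) (auto simp: eventually_nhds subset_eq)
  then show "{x \<in> space borel. f x < y} \<in> sets borel"
    by simp
qed

lemma covering_number_antimono:
  assumes "\<And>x. g x \<le> h x"
  shows "covering_number f h \<le> covering_number f g"
proof -
  have "conv_fun \<mu> g x \<le> conv_fun \<mu> h x" for \<mu> x
    unfolding conv_fun_def by (intro nn_integral_mono ennreal_leI assms)
  then show ?thesis
    unfolding covering_number_def by (intro Inf_superset_mono) (blast intro: order_trans)
qed

section \<open>Covering bounds from autoconvolutions\<close>

lemma covering_number_mult_autoconvolution_le:
  fixes f g :: "real ^ 'n \<Rightarrow> real"
  assumes [measurable]: "f \<in> borel_measurable borel" "g \<in> borel_measurable borel"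
    and f0: "\<And>x. 0 \<le> f x" and g0: "\<And>x. 0 \<le> g x"
    and fg: "\<And>x y. f x * g y \<le> (f ((1/2) *\<^sub>R (x + y)))\<^sup>2"
    and fin: "(\<integral>\<^sup>+ z. ennreal (g (c - z) * g z) \<partial>lborel) \<noteq> \<infinity>"
  shows "covering_number f g * (\<integral>\<^sup>+ z. ennreal (g (c - z) * g z) \<partial>lborel)
    \<le> 2 ^ CARD('n) * (\<integral>\<^sup>+ x. ennreal ((f x)\<^sup>2) \<partial>lborel)"
proof (cases "(\<integral>\<^sup>+ z. ennreal (g (c - z) * g z) \<partial>lborel) = 0")
  \<comment> \<open>Here \<open>covering_number f g\<close> may be infinite, but the left side is
    still 0, since \<open>\<infinity> * 0 = 0\<close> in \<open>ennreal\<close>.\<close>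
  case True
  then show ?thesis by simp
next
  case False
  define D where "D = (\<integral>\<^sup>+ z. ennreal (g (c - z) * g z) \<partial>lborel)"
  have D: "D \<noteq> 0" "D \<noteq> \<infinity>"
    using False fin by (auto simp: D_def)
  define h where "h t = ennreal ((f ((1/2) *\<^sub>R (c + t)))\<^sup>2) / D" for t
  have [measurable]: "h \<in> borel_measurable borel"
    unfolding h_def by measurable
  define \<mu> where "\<mu> = density lborel h"
  \<comment> \<open>Substituting \<open>z = x - t\<close> pairs \<open>x\<close> with
    \<open>c - (x - t)\<close>. Their sum is \<open>c + t\<close>, so the bound from
    \<open>fg\<close> no longer involves \<open>x\<close>, and one density \<open>h\<close> serves
    all points.\<close>
  have "ennreal (f x) \<le> conv_fun \<mu> g x" for x
  proof -
    have "ennreal (f x) * D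
        = (\<integral>\<^sup>+ z. ennreal (f x) * ennreal (g (c - z) * g z) \<partial>lborel)"
      unfolding D_def by (simp add: nn_integral_cmult)
    also have "\<dots> = (\<integral>\<^sup>+ t. ennreal (f x) * ennreal (g (c - (x - t)) * g (x - t)) \<partial>lborel)"
      by (subst nn_integral_lborel_affine[where c = "-1" and a = x]) simp_all
    also have "\<dots> \<le> (\<integral>\<^sup>+ t. ennreal ((f ((1/2) *\<^sub>R (c + t)))\<^sup>2) * ennreal (g (x - t)) \<partial>lborel)"
    proof (rule nn_integral_mono)
      fix t
      have "f x * g (c - (x - t)) * g (x - t) \<le> (f ((1/2) *\<^sub>R (c + t)))\<^sup>2 * g (x - t)"
        using fg[of x "c - (x - t)"] g0 by (intro mult_right_mono) simp_all
      then show "ennreal (f x) * ennreal (g (c - (x - t)) * g (x - t))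
          \<le> ennreal ((f ((1/2) *\<^sub>R (c + t)))\<^sup>2) * ennreal (g (x - t))"
        using f0 g0 by (simp add: ennreal_mult[symmetric] ennreal_leI mult.assoc)
    qed
    also have "\<dots> = (\<integral>\<^sup>+ t. (h t * ennreal (g (x - t))) * D \<partial>lborel)"
    proof (rule nn_integral_cong)
      fix t
      have "h t * D = ennreal ((f ((1/2) *\<^sub>R (c + t)))\<^sup>2)"
        unfolding h_def using D by (simp add: ennreal_divide_times ennreal_divide_self less_top)
      then show "ennreal ((f ((1/2) *\<^sub>R (c + t)))\<^sup>2) * ennreal (g (x - t))
          = (h t * ennreal (g (x - t))) * D"
        by (metis mult.assoc mult.commute)
    qed
    also have "\<dots> = conv_fun \<mu> g x * D"
      unfolding conv_fun_def \<mu>_def by (simp add: nn_integral_density nn_integral_multc)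
    finally show ?thesis
      using D by (simp add: ennreal_mult_le_mult_iff mult.commute[of _ D])
  qed
  then have "covering_number f g \<le> emeasure \<mu> UNIV"
    unfolding covering_number_def by (intro Inf_lower) (auto simp: \<mu>_def)
  also have "\<dots> = (\<integral>\<^sup>+ t. ennreal ((f ((1/2) *\<^sub>R (c + t)))\<^sup>2) \<partial>lborel) / D"
    unfolding \<mu>_def by (simp add: emeasure_density h_def nn_integral_divide)
  \<comment> \<open>The factor 2^n is the Jacobian of \<open>t = 2 x - c\<close>, which undoes the
    midpoint.\<close>
  also have "(\<integral>\<^sup>+ t. ennreal ((f ((1/2) *\<^sub>R (c + t)))\<^sup>2) \<partial>lborel)
      = 2 ^ CARD('n) * (\<integral>\<^sup>+ x. ennreal ((f x)\<^sup>2) \<partial>lborel)"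
    by (subst nn_integral_lborel_affine[where c = 2 and a = "- c"])
      (simp_all flip: ennreal_power)
  finally have "covering_number f g * D
      \<le> 2 ^ CARD('n) * (\<integral>\<^sup>+ x. ennreal ((f x)\<^sup>2) \<partial>lborel) / D * D"
    by (rule mult_right_mono) simp
  then show ?thesis
    using D by (simp add: D_def[symmetric] ennreal_divide_times ennreal_divide_self less_top)
qed

text \<open>With \<open>c\<close> the sum of the two variables, the squared integral is the double
  integral of the square of \<open>g (c - z) * g z\<close>. One copy of this product is bounded by
  the value of \<open>g\<^sup>2\<close> at the midpoint \<open>c / 2\<close>, which does not depend
  on \<open>z\<close>; the other copy integrates in \<open>z\<close> to the autoconvolution.\<close>

lemma square_nn_integral_square_le_autoconvolution:
  fixes g :: "real ^ 'n \<Rightarrow> real"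
  assumes [measurable]: "g \<in> borel_measurable borel"
    and g0: "\<And>x. 0 \<le> g x"
    and gg: "\<And>x y. g x * g y \<le> (g ((1/2) *\<^sub>R (x + y)))\<^sup>2"
  shows "(\<integral>\<^sup>+ x. ennreal ((g x)\<^sup>2) \<partial>lborel)\<^sup>2
    \<le> (\<integral>\<^sup>+ c. (\<integral>\<^sup>+ z. ennreal (g (c - z) * g z) \<partial>lborel) * ennreal ((g ((1/2) *\<^sub>R c))\<^sup>2) \<partial>lborel)"
proof -
  define A where "A = (\<integral>\<^sup>+ x. ennreal ((g x)\<^sup>2) \<partial>lborel)"
  have "A\<^sup>2 = (\<integral>\<^sup>+ z. A * ennreal ((g z)\<^sup>2) \<partial>lborel)"
    by (simp add: nn_integral_cmult A_def power2_eq_square)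
  also have "\<dots> = (\<integral>\<^sup>+ z. (\<integral>\<^sup>+ c. ennreal ((g (c - z))\<^sup>2) * ennreal ((g z)\<^sup>2) \<partial>lborel) \<partial>lborel)"
  proof (rule nn_integral_cong)
    fix z
    have "A = (\<integral>\<^sup>+ c. ennreal ((g (c - z))\<^sup>2) \<partial>lborel)"
      unfolding A_def by (subst nn_integral_lborel_affine[where c = 1 and a = "- z"]) simp_all
    then show "A * ennreal ((g z)\<^sup>2)
        = (\<integral>\<^sup>+ c. ennreal ((g (c - z))\<^sup>2) * ennreal ((g z)\<^sup>2) \<partial>lborel)"
      by (simp add: nn_integral_multc)
  qed
  also have "\<dots> = (\<integral>\<^sup>+ c. (\<integral>\<^sup>+ z. ennreal ((g (c - z))\<^sup>2) * ennreal ((g z)\<^sup>2) \<partial>lborel) \<partial>lborel)"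
    by (rule lborel_pair.Fubini') measurable
  also have "\<dots> \<le> (\<integral>\<^sup>+ c. (\<integral>\<^sup>+ z. ennreal (g (c - z) * g z) * ennreal ((g ((1/2) *\<^sub>R c))\<^sup>2) \<partial>lborel) \<partial>lborel)"
  proof (intro nn_integral_mono)
    fix c z
    have "(g (c - z) * g z) * (g (c - z) * g z) \<le> (g (c - z) * g z) * (g ((1/2) *\<^sub>R c))\<^sup>2"
      using gg[of "c - z" z] g0 by (intro mult_left_mono) simp_all
    then show "ennreal ((g (c - z))\<^sup>2) * ennreal ((g z)\<^sup>2)
        \<le> ennreal (g (c - z) * g z) * ennreal ((g ((1/2) *\<^sub>R c))\<^sup>2)"
      using g0 by (simp add: ennreal_mult[symmetric] ennreal_leI power2_eq_square ac_simps)
  qed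
  also have "\<dots> = (\<integral>\<^sup>+ c. (\<integral>\<^sup>+ z. ennreal (g (c - z) * g z) \<partial>lborel) * ennreal ((g ((1/2) *\<^sub>R c))\<^sup>2) \<partial>lborel)"
    by (simp add: nn_integral_multc)
  finally show ?thesis
    by (simp add: A_def)
qed

text \<open>The factor 4^n is 2^n taken twice: once from the covering bound at each
  \<open>c\<close>, once from rescaling the weight. The common factor of both sides is cancelled
  later, where it is known to be positive and finite.\<close>

lemma covering_number_mult_square_le:
  fixes f g :: "real ^ 'n \<Rightarrow> real"
  assumes [measurable]: "f \<in> borel_measurable borel" "g \<in> borel_measurable borel"
    and f0: "\<And>x. 0 \<le> f x" and g0: "\<And>x. 0 \<le> g x"
    and fg: "\<And>x y. f x * g y \<le> (f ((1/2) *\<^sub>R (x + y)))\<^sup>2"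
    and gg: "\<And>x y. g x * g y \<le> (g ((1/2) *\<^sub>R (x + y)))\<^sup>2"
    and fin: "\<And>c. (\<integral>\<^sup>+ z. ennreal (g (c - z) * g z) \<partial>lborel) \<noteq> \<infinity>"
  shows "covering_number f g * (\<integral>\<^sup>+ x. ennreal ((g x)\<^sup>2) \<partial>lborel)\<^sup>2
    \<le> 4 ^ CARD('n) * (\<integral>\<^sup>+ x. ennreal ((f x)\<^sup>2) \<partial>lborel) * (\<integral>\<^sup>+ x. ennreal ((g x)\<^sup>2) \<partial>lborel)"
proof -
  let ?N = "covering_number f g"
  let ?C = "\<lambda>c. \<integral>\<^sup>+ z. ennreal (g (c - z) * g z) \<partial>lborel"
  let ?w = "\<lambda>c. ennreal ((g ((1/2) *\<^sub>R c))\<^sup>2)"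
  let ?A = "\<integral>\<^sup>+ x. ennreal ((f x)\<^sup>2) \<partial>lborel" and ?B = "\<integral>\<^sup>+ x. ennreal ((g x)\<^sup>2) \<partial>lborel"
  have [measurable]: "?C \<in> borel_measurable borel"
    by measurable
  have "?N * ?B\<^sup>2 \<le> ?N * (\<integral>\<^sup>+ c. ?C c * ?w c \<partial>lborel)"
    by (intro mult_left_mono square_nn_integral_square_le_autoconvolution assms) simp_all
  also have "\<dots> = (\<integral>\<^sup>+ c. (?N * ?C c) * ?w c \<partial>lborel)"
    by (simp add: nn_integral_cmult mult.assoc)
  also have "\<dots> \<le> (\<integral>\<^sup>+ c. (2 ^ CARD('n) * ?A) * ?w c \<partial>lborel)"
    by (intro nn_integral_mono mult_right_mono covering_number_mult_autoconvolution_le assms)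
      simp_all
  also have "\<dots> = 2 ^ CARD('n) * ?A * (\<integral>\<^sup>+ c. ?w c \<partial>lborel)"
    by (simp add: nn_integral_cmult)
  also have "(\<integral>\<^sup>+ c. ?w c \<partial>lborel) = 2 ^ CARD('n) * ?B"
    by (subst nn_integral_lborel_affine[where c = 2 and a = 0]) (simp_all flip: ennreal_power)
  also have "2 ^ CARD('n) * ?A * (2 ^ CARD('n) * ?B) = (2 * 2) ^ CARD('n) * ?A * ?B"
    by (simp only: power_mult_distrib ac_simps)
  finally show ?thesis by simp
qed

section \<open>Log-concavity of functions in \<open>LC_g\<close> and of their dilates\<close>

lemma LC_g_bounds:
  assumes "f \<in> LC_g"
  shows "0 \<le> f x" "f x \<le> 1"
  using assms unfolding LC_g_def by auto

text \<open>Convexity of \<open>neg_log f\<close>, exponentiated. Zeros of \<open>f\<close> are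
  treated apart: there the left side vanishes because \<open>0 powr u = 0\<close>.\<close>

lemma LC_g_powr_le:
  assumes "f \<in> LC_g" "0 < u" "0 < v" "u + v = 1"
  shows "f x powr u * f y powr v \<le> f (u *\<^sub>R x + v *\<^sub>R y)"
proof (cases "f x = 0 \<or> f y = 0")
  case True
  then show ?thesis using LC_g_bounds(1)[OF assms(1)] by auto
next
  case False
  then have pos: "0 < f x" "0 < f y"
    using LC_g_bounds(1)[OF assms(1)] by (auto simp: less_le)
  let ?z = "u *\<^sub>R x + v *\<^sub>R y"
  have "neg_log f ?z \<le> ereal u * neg_log f x + ereal v * neg_log f y"
    using assms unfolding LC_g_def ereal_convex_def by auto
  then have le: "neg_log f ?z \<le> ereal (- u * ln (f x) - v * ln (f y))"
    using False by (simp add: neg_log_def)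
  \<comment> \<open>The upper bound is finite, whereas \<open>neg_log\<close> is infinite at zeros
    of \<open>f\<close>.\<close>
  then have "f ?z \<noteq> 0"
    by (auto simp: neg_log_def)
  then have z: "0 < f ?z"
    using LC_g_bounds(1)[OF assms(1), of ?z] by simp
  with le have "u * ln (f x) + v * ln (f y) \<le> ln (f ?z)"
    by (simp add: neg_log_def)
  then have "exp (u * ln (f x) + v * ln (f y)) \<le> exp (ln (f ?z))"
    by (simp only: exp_le_cancel_iff)
  then show ?thesis
    using pos z by (simp add: powr_def exp_add)
qed

text \<open>The midpoint case, squared; this is the form of log-concavity that the covering bounds
  use.\<close>

lemma LC_g_mult_le:
  assumes "f \<in> LC_g"
  shows "f x * f y \<le> (f ((1/2) *\<^sub>R (x + y)))\<^sup>2"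
proof -
  have "f x powr (1/2) * f y powr (1/2) \<le> f ((1/2) *\<^sub>R (x + y))"
    using LC_g_powr_le[OF assms, of "1/2" "1/2" x y] by (simp add: scaleR_add_right)
  then have "sqrt (f x * f y) \<le> f ((1/2) *\<^sub>R (x + y))"
    using LC_g_bounds(1)[OF assms] by (simp add: powr_half_sqrt real_sqrt_mult)
  then show ?thesis
    using sqrt_le_D by blast
qed

lemma dilate_nonneg: "0 \<le> dilate l f x"
  by (simp add: dilate_def)

lemma dilate_one: "(\<And>x. 0 \<le> f x) \<Longrightarrow> dilate 1 f = f"
  by (auto simp: dilate_def fun_eq_iff)

lemma borel_measurable_dilate [measurable]:
  fixes f :: "real ^ 'n \<Rightarrow> real"
  assumes [measurable]: "f \<in> borel_measurable borel"
  shows "dilate l f \<in> borel_measurable borel"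
  unfolding dilate_def by measurable

text \<open>The point \<open>x /\<^sub>R m\<close> is the convex combination of
  \<open>x /\<^sub>R l\<close> and 0 with weight \<open>l / m\<close> on the former, and the factor
  at 0 disappears because \<open>f 0 = 1\<close>. Raising to the power \<open>m\<close> then gives
  the claim. The case \<open>l = m\<close> is separate since both weights must be positive.\<close>

lemma dilate_mono:
  assumes f: "f \<in> LC_g" and lm: "0 < l" "l \<le> m"
  shows "dilate l f x \<le> dilate m f x"
proof (cases "l = m")
  case False
  have "f (x /\<^sub>R l) powr (l / m) * f 0 powr (1 - l / m)
      \<le> f ((l / m) *\<^sub>R (x /\<^sub>R l) + (1 - l / m) *\<^sub>R 0)"
    using lm False by (intro LC_g_powr_le f) auto
  then have "f (x /\<^sub>R l) powr (l / m) \<le> f (x /\<^sub>R m)"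
    using f lm by (simp add: LC_g_def divide_simps)
  then have "(f (x /\<^sub>R l) powr (l / m)) powr m \<le> f (x /\<^sub>R m) powr m"
    using lm by (intro powr_mono2) auto
  then show ?thesis
    using lm by (simp add: dilate_def powr_powr)
qed simp

lemma dilate_le:
  assumes "f \<in> LC_g" "0 < l" "l \<le> 1"
  shows "dilate l f x \<le> f x"
  using dilate_mono[OF assms, of x] dilate_one[of f, OF LC_g_bounds(1)[OF assms(1)]] by simp

text \<open>Midpoints commute with the scaling of the argument, and \<open>powr l\<close> is
  multiplicative and monotone on non-negative reals, so the inequality passes from \<open>f\<close>
  to its dilate.\<close>

lemma dilate_mult_le:
  assumes f: "f \<in> LC_g" and "0 < l"
  shows "dilate l f x * dilate l f y \<le> (dilate l f ((1/2) *\<^sub>R (x + y)))\<^sup>2"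
proof -
  have "dilate l f x * dilate l f y = (f (x /\<^sub>R l) * f (y /\<^sub>R l)) powr l"
    using LC_g_bounds(1)[OF f] by (simp add: dilate_def powr_mult)
  also have "\<dots> \<le> ((f ((1/2) *\<^sub>R (x /\<^sub>R l + y /\<^sub>R l)))\<^sup>2) powr l"
    using LC_g_bounds(1)[OF f] assms by (intro powr_mono2 LC_g_mult_le) auto
  also have "\<dots> = (dilate l f ((1/2) *\<^sub>R (x + y)))\<^sup>2"
    using LC_g_bounds(1)[OF f]
    by (simp add: dilate_def power2_eq_square powr_mult scaleR_add_right mult.commute)
  finally show ?thesis .
qed

text \<open>The scaling of the argument costs exactly the Jacobian \<open>l ^ CARD('n)\<close>,
  while the exponent \<open>l \<le> 1\<close> only increases values in [0,1].\<close>

lemma nn_integral_dilate_square_ge: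
  fixes f :: "real ^ 'n \<Rightarrow> real"
  assumes [measurable]: "f \<in> borel_measurable borel" and f: "\<And>x. 0 \<le> f x" "\<And>x. f x \<le> 1"
    and l: "0 < l" "l \<le> 1"
  shows "ennreal (l ^ CARD('n)) * (\<integral>\<^sup>+ x. ennreal ((f x)\<^sup>2) \<partial>lborel)
    \<le> (\<integral>\<^sup>+ x. ennreal ((dilate l f x)\<^sup>2) \<partial>lborel)"
proof -
  have "f x \<le> f x powr l" for x
    using powr_mono'[of l 1 "f x"] l f[of x] by (cases "f x = 0") auto
  then have "(f x)\<^sup>2 \<le> (f x powr l)\<^sup>2" for x
    using f by (intro power_mono) auto
  then have "ennreal (l ^ CARD('n)) * (\<integral>\<^sup>+ x. ennreal ((f x)\<^sup>2) \<partial>lborel)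
      \<le> ennreal (l ^ CARD('n)) * (\<integral>\<^sup>+ x. ennreal ((f x powr l)\<^sup>2) \<partial>lborel)"
    by (intro mult_left_mono nn_integral_mono ennreal_leI) simp_all
  also have "\<dots> = (\<integral>\<^sup>+ x. ennreal ((dilate l f x)\<^sup>2) \<partial>lborel)"
    using l by (subst (2) nn_integral_lborel_affine[where c = l and a = 0])
      (simp_all add: dilate_def)
  finally show ?thesis .
qed

section \<open>Left limits, cancellation of the integrals, and the final bounds\<close>

lemma tendsto_at_left_INF:
  fixes N :: "real \<Rightarrow> 'b::{complete_linorder, linorder_topology}"
  assumes "a < b" and anti: "\<And>x y. a < x \<Longrightarrow> x \<le> y \<Longrightarrow> y < b \<Longrightarrow> N y \<le> N x"
  shows "(N \<longlongrightarrow> (INF x\<in>{a<..<b}. N x)) (at_left b)"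
proof (rule order_tendstoI)
  have ev: "\<forall>\<^sub>F x in at_left b. x \<in> {z<..<b}" if "z < b" for z
    using that by (rule eventually_at_leftI[rotated]) auto
  fix u
  {
    assume u: "u < (INF x\<in>{a<..<b}. N x)"
    show "\<forall>\<^sub>F x in at_left b. u < N x"
      using ev[OF \<open>a < b\<close>] by eventually_elim (rule less_le_trans[OF u INF_lower])
  next
    assume "(INF x\<in>{a<..<b}. N x) < u"
    then obtain z where z: "a < z" "z < b" "N z < u"
      by (auto simp: INF_less_iff)
    show "\<forall>\<^sub>F x in at_left b. N x < u"
      using ev[OF z(2)]
      by eventually_elim (use z in \<open>auto intro: le_less_trans[OF anti]\<close>)
  }
qed

text \<open>Applied with \<open>A\<close> and \<open>B\<close> the integrals of the squares of
  \<open>f\<close> and of its dilate, and \<open>r = l ^ CARD('n)\<close>. Cancelling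
  \<open>A\<close> in \<open>ennreal\<close> requires it to be neither 0 nor infinite.\<close>

lemma ennreal_le_of_mult_le:
  fixes N A B C :: ennreal
  assumes "N * B \<le> C * A" "ennreal r * A \<le> B" "A \<noteq> 0" "A \<noteq> \<infinity>" "0 < r"
  shows "N \<le> C * ennreal (1 / r)"
proof -
  have "A * (N * ennreal r) = N * (ennreal r * A)"
    by (simp add: ac_simps)
  also have "\<dots> \<le> A * C"
    using mult_left_mono[OF assms(2), of N] assms(1) by (simp add: mult.commute)
  finally have "N * ennreal r \<le> C"
    using assms by (simp add: ennreal_mult_le_mult_iff)
  then have "N * ennreal r * ennreal (1 / r) \<le> C * ennreal (1 / r)"
    by (rule mult_right_mono) simp
  moreover have "ennreal r * ennreal (1 / r) = 1"
    using assms by (simp flip: ennreal_mult)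
  ultimately show ?thesis
    by (simp add: mult.assoc)
qed

lemma covering_number_dilate_le:
  fixes f :: "real ^ 'n \<Rightarrow> real"
  assumes f: "f \<in> LC_g" and l: "0 < l" "l < 1"
  shows "(\<forall>x. f (- x) = f x) \<Longrightarrow>
      covering_number f (dilate l f) \<le> 2 ^ CARD('n) * ennreal (1 / l ^ CARD('n))" (is "?even \<Longrightarrow> ?P2")
    and "covering_number f (dilate l f) \<le> 4 ^ CARD('n) * ennreal (1 / l ^ CARD('n))"
proof -
  have fm [measurable]: "f \<in> borel_measurable borel"
    using f by (intro upper_semicontinuous_borel_measurable) (simp add: LC_g_def)
  note f01 = LC_g_bounds[OF f]
  define g where "g = dilate l f"
  have gm [measurable]: "g \<in> borel_measurable borel"
    unfolding g_def by measurable
  have g0: "0 \<le> g x" and gf: "g x \<le> f x" for x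
    using dilate_nonneg[of l f x] dilate_le[OF f, of l x] l by (simp_all add: g_def)
  have gg: "g x * g y \<le> (g ((1/2) *\<^sub>R (x + y)))\<^sup>2" for x y
    unfolding g_def by (rule dilate_mult_le[OF f l(1)])
  have fg: "f x * g y \<le> (f ((1/2) *\<^sub>R (x + y)))\<^sup>2" for x y
    using mult_left_mono[OF gf f01(1), of x y] LC_g_mult_le[OF f, of x y] by simp
  let ?A = "\<integral>\<^sup>+ x. ennreal ((f x)\<^sup>2) \<partial>lborel" and ?B = "\<integral>\<^sup>+ x. ennreal ((g x)\<^sup>2) \<partial>lborel"
  have int: "(\<integral>\<^sup>+ x. ennreal (f x) \<partial>lborel) \<noteq> 0" "(\<integral>\<^sup>+ x. ennreal (f x) \<partial>lborel) < \<infinity>"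
    using f by (auto simp: LC_g_def)
  have fin: "(\<integral>\<^sup>+ z. ennreal (g (c - z) * g z) \<partial>lborel) \<noteq> \<infinity>" for c
  proof -
    have "g (c - z) * g z \<le> f z" for z
      using mult_mono[OF order_trans[OF gf f01(2)] gf zero_le_one g0, of "c - z" z] by simp
    then have "(\<integral>\<^sup>+ z. ennreal (g (c - z) * g z) \<partial>lborel) \<le> (\<integral>\<^sup>+ x. ennreal (f x) \<partial>lborel)"
      by (intro nn_integral_mono ennreal_leI)
    then show ?thesis using int(2) by auto
  qed
  \<comment> \<open>For non-negative \<open>f\<close>, the integrals of \<open>f\<close> and of its
    square vanish together: each does exactly when \<open>f\<close> is 0 almost everywhere.\<close>
  have A0: "?A \<noteq> 0"
    using int(1) f01(1) by (simp add: nn_integral_0_iff_AE)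
  have "(f x)\<^sup>2 \<le> f x" for x
    using mult_left_le[OF f01(2,1), of x x] by (simp add: power2_eq_square)
  then have "?A \<le> (\<integral>\<^sup>+ x. ennreal (f x) \<partial>lborel)"
    by (intro nn_integral_mono ennreal_leI)
  then have A1: "?A \<noteq> \<infinity>" using int(2) by auto
  have "(g x)\<^sup>2 \<le> (f x)\<^sup>2" for x
    using gf g0 by (intro power_mono) auto
  then have "?B \<le> ?A"
    by (intro nn_integral_mono ennreal_leI)
  then have B1: "?B \<noteq> \<infinity>" using A1 by (auto simp: top_unique)
  have AB: "ennreal (l ^ CARD('n)) * ?A \<le> ?B"
    unfolding g_def using l by (intro nn_integral_dilate_square_ge f01) simp_all
  have lpos: "0 < l ^ CARD('n)" using l by simp
  have B0: "?B \<noteq> 0"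
    using AB A0 lpos by (auto simp: ennreal_eq_0_iff)
  show ?P2 if ?even
  proof -
    \<comment> \<open>Evenness makes the autoconvolution at 0 equal to \<open>?B\<close>, so no
      averaging over \<open>c\<close> is required.\<close>
    have "g (0 - z) * g z = (g z)\<^sup>2" for z
      using that by (simp add: g_def dilate_def power2_eq_square)
    then have "covering_number f g * ?B \<le> 2 ^ CARD('n) * ?A"
      using covering_number_mult_autoconvolution_le[OF fm gm f01(1) g0 fg fin, of 0] by simp
    then show ?thesis
      unfolding g_def[symmetric] using AB A0 A1 lpos by (rule ennreal_le_of_mult_le)
  qed
  \<comment> \<open>Without evenness, the averaged bound is used; it has a spare factor
    \<open>?B\<close> on both sides, which \<open>B0\<close> and \<open>B1\<close> allow to be
    cancelled.\<close>
  have "?B * (covering_number f g * ?B) \<le> ?B * (4 ^ CARD('n) * ?A)"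
    using covering_number_mult_square_le[OF fm gm f01(1) g0 fg gg fin]
    by (simp add: power2_eq_square ac_simps)
  then have "covering_number f g * ?B \<le> 4 ^ CARD('n) * ?A"
    using B0 B1 by (simp add: ennreal_mult_le_mult_iff)
  then show "covering_number f (dilate l f) \<le> 4 ^ CARD('n) * ennreal (1 / l ^ CARD('n))"
    unfolding g_def[symmetric] using AB A0 A1 lpos by (rule ennreal_le_of_mult_le)
qed

theorem theorem5p3:
  fixes f :: "real ^ 'n \<Rightarrow> real"
  assumes "f \<in> LC_g"
  shows "\<exists>L. ((\<lambda>l. covering_number f (dilate l f)) \<longlongrightarrow> L) (at_left 1) \<and>
    ((\<forall>x. f (- x) = f x) \<longrightarrow> L \<le> 2 ^ CARD('n)) \<and>
    (\<not> (\<forall>x. f (- x) = f x) \<longrightarrow> L \<le> 4 ^ CARD('n))"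
proof -
  define N where "N l = covering_number f (dilate l f)" for l
  define L where "L = (INF l\<in>{0<..<1}. N l)"
  have lim: "(N \<longlongrightarrow> L) (at_left 1)"
    unfolding L_def N_def
    by (intro tendsto_at_left_INF covering_number_antimono dilate_mono assms) simp_all
  \<comment> \<open>Instantiated with \<open>k = 2\<close> and \<open>k = 4\<close>. The bound tends
    to \<open>k ^ CARD('n)\<close> as \<open>l\<close> tends to 1; finiteness of \<open>k\<close>
    makes multiplication by the constant continuous in \<open>ennreal\<close>.\<close>
  have le: "L \<le> k ^ CARD('n)"
    if "\<And>l. 0 < l \<Longrightarrow> l < 1 \<Longrightarrow> N l \<le> k ^ CARD('n) * ennreal (1 / l ^ CARD('n))" "k < \<infinity>"
    for k :: ennreal
  proof -
    have "((\<lambda>l. k ^ CARD('n) * ennreal (1 / l ^ CARD('n)))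
        \<longlongrightarrow> k ^ CARD('n) * ennreal (1 / 1 ^ CARD('n))) (at_left 1)"
      using that(2)
      by (intro ennreal_tendsto_cmult tendsto_ennrealI tendsto_intros)
        (simp_all add: power_less_top_ennreal)
    moreover have "\<forall>\<^sub>F l in at_left 1. N l \<le> k ^ CARD('n) * ennreal (1 / l ^ CARD('n))"
      using that(1) by (intro eventually_at_leftI[of 0]) simp_all
    ultimately show ?thesis
      using tendsto_le[OF _ _ lim] by fastforce
  qed
  show ?thesis
    using lim le[of 2] le[of 4] covering_number_dilate_le[OF assms]
    unfolding N_def by (intro exI[of _ L]) auto
qed

end
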